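(* Let $G$ be a group generated by two commuting infinite finitely generated subgroups $H$ and $K$. Let $G\overset{\alpha}{\curvearrowright}(X,\mu)$ be a free probability measure preserving action on a standard Borel probability space such that $H$ acts strongly ergodically and $K$ acts ergodically. Then the orbit equivalence relation ${\mathcal{R}}_{\alpha}=\{(x,\alpha(g)(x)) : x\in X,\ g\in G\}$ admits no non-trivial approximation.
   Context: "Commuting subgroups" means that every element of $H$ commutes with every element of $K$. A p.m.p. (probability measure preserving) action of a countable group $\Gamma$ on $(X,\mu)$ is strongly ergodic if for every sequence $(A_n)$ of Borel subsets of $X$ with $\lim_{n\to\infty}\mu(A_n\,\Delta\, g A_n)=0$ for each $g\in\Gamma$, one has $\mu(A_n)(1-\mu(A_n))\to 0$. Let ${\mathcal{R}}$ be a standard p.m.p. equivalence relation on $(X,\mu)$ (Borel, with countable classes, preserving $\mu$). An approximation of ${\mathcal{R}}$ is an increasing sequence $({\mathcal{R}}_n)_{n\in\mathbb{N}}$ of standard (Borel) sub-equivalence relations of ${\mathcal{R}}$ with $\bigcup_{n}{\mathcal{R}}_n={\mathcal{R}}$. It is trivial if there are some $n$ and a Borel subset $A\subset X$ with $\mu(A)>0$ such that the restrictions coincide: ${\mathcal{R}}_n{\upharpoonright}A={\mathcal{R}}{\upharpoonright}A$, where ${\mathcal{R}}{\upharpoonright}A={\mathcal{R}}\cap(A\times A)$. As usual in measured theory, equalities and inclusions are understood up to null sets. *)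

theory Defs
  imports "HOL-Probability.Probability" "HOL-Algebra.Algebra"
begin

definition finitely_generated_subgroup :: "('g, 'b) monoid_scheme \<Rightarrow> 'g set \<Rightarrow> bool"
  where "finitely_generated_subgroup G H \<longleftrightarrow>
    subgroup H G \<and> (\<exists>S. finite S \<and> S \<subseteq> carrier G \<and> generate G S = H)"

definition commuting_subgroups :: "('g, 'b) monoid_scheme \<Rightarrow> 'g set \<Rightarrow> 'g set \<Rightarrow> bool"
  where "commuting_subgroups G H K \<longleftrightarrow> (\<forall>h\<in>H. \<forall>k\<in>K. h \<otimes>\<^bsub>G\<^esub> k = k \<otimes>\<^bsub>G\<^esub> h)"

definition standard_borel :: "'x measure \<Rightarrow> bool"
  where "standard_borel M \<longleftrightarrow>
    (\<exists>T. completely_metrizable_space T \<and> second_countable T \<and> topspace T = space M \<and>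
         sets M = sigma_sets (space M) {U. openin T U})"

definition pmp_action :: "('g, 'b) monoid_scheme \<Rightarrow> 'x measure \<Rightarrow> ('g \<Rightarrow> 'x \<Rightarrow> 'x) \<Rightarrow> bool"
  where "pmp_action G M \<alpha> \<longleftrightarrow>
    prob_space M \<and> group_action G (space M) \<alpha> \<and>
    (\<forall>g\<in>carrier G. \<alpha> g \<in> measurable M M \<and> distr M M (\<alpha> g) = M)"

(* Freeness up to null sets: almost every point has trivial stabiliser. *)
definition free_action :: "('g, 'b) monoid_scheme \<Rightarrow> 'x measure \<Rightarrow> ('g \<Rightarrow> 'x \<Rightarrow> 'x) \<Rightarrow> bool"
  where "free_action G M \<alpha> \<longleftrightarrow>
    (AE x in M. \<forall>g\<in>carrier G. g \<noteq> \<one>\<^bsub>G\<^esub> \<longrightarrow> \<alpha> g x \<noteq> x)"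

(* In the next two definitions H is the set of group elements whose action is considered. *)
definition ergodic :: "'g set \<Rightarrow> 'x measure \<Rightarrow> ('g \<Rightarrow> 'x \<Rightarrow> 'x) \<Rightarrow> bool"
  where "ergodic H M \<alpha> \<longleftrightarrow>
    (\<forall>A\<in>sets M. (\<forall>g\<in>H. measure M (sym_diff A (\<alpha> g ` A)) = 0) \<longrightarrow>
       measure M A = 0 \<or> measure M A = 1)"

definition strongly_ergodic :: "'g set \<Rightarrow> 'x measure \<Rightarrow> ('g \<Rightarrow> 'x \<Rightarrow> 'x) \<Rightarrow> bool"
  where "strongly_ergodic H M \<alpha> \<longleftrightarrow>
    (\<forall>A :: nat \<Rightarrow> 'x set. (\<forall>n. A n \<in> sets M) \<longrightarrow>
       (\<forall>g\<in>H. (\<lambda>n. measure M (sym_diff (A n) (\<alpha> g ` A n))) \<longlonglongrightarrow> 0) \<longrightarrow>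
       (\<lambda>n. measure M (A n) * (1 - measure M (A n))) \<longlonglongrightarrow> 0)"

definition orbit_rel :: "('g, 'b) monoid_scheme \<Rightarrow> 'x measure \<Rightarrow> ('g \<Rightarrow> 'x \<Rightarrow> 'x) \<Rightarrow> 'x rel"
  where "orbit_rel G M \<alpha> = {(x, \<alpha> g x) | x g. x \<in> space M \<and> g \<in> carrier G}"

(* Inclusion and equality of relations up to null sets: they hold on a conull set. *)
definition ae_subrel :: "'x measure \<Rightarrow> 'x rel \<Rightarrow> 'x rel \<Rightarrow> bool"
  where "ae_subrel M R S \<longleftrightarrow>
    (\<exists>N\<in>null_sets M. Restr R (space M - N) \<subseteq> Restr S (space M - N))"

definition ae_eqrel :: "'x measure \<Rightarrow> 'x rel \<Rightarrow> 'x rel \<Rightarrow> bool"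
  where "ae_eqrel M R S \<longleftrightarrow>
    (\<exists>N\<in>null_sets M. Restr R (space M - N) = Restr S (space M - N))"

definition borel_equiv_rel :: "'x measure \<Rightarrow> 'x rel \<Rightarrow> bool"
  where "borel_equiv_rel M R \<longleftrightarrow> equiv (space M) R \<and> R \<in> sets (M \<Otimes>\<^sub>M M)"

(* Meant for a standard p.m.p. R. Countability of the classes and preservation of the measure
   then pass to sub-relations (up to null sets), so only Borelness is demanded of each Rs n. *)
definition approximation :: "'x measure \<Rightarrow> 'x rel \<Rightarrow> (nat \<Rightarrow> 'x rel) \<Rightarrow> bool"
  where "approximation M R Rs \<longleftrightarrow>
    (\<forall>n. borel_equiv_rel M (Rs n) \<and> ae_subrel M (Rs n) R) \<and>
    (\<forall>n. ae_subrel M (Rs n) (Rs (Suc n))) \<and>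
    ae_eqrel M (\<Union>n. Rs n) R"

definition trivial_approximation :: "'x measure \<Rightarrow> 'x rel \<Rightarrow> (nat \<Rightarrow> 'x rel) \<Rightarrow> bool"
  where "trivial_approximation M R Rs \<longleftrightarrow>
    (\<exists>n. \<exists>A\<in>sets M. measure M A > 0 \<and> ae_eqrel M (Restr (Rs n) A) (Restr R A))"

end

theory Submission
  imports Defs
begin

text \<open>
  Let E(n,g) be the set of points x with (x, gx) in the n-th sub-relation; its measure tends to 1
  for each g.  As k commutes with h, the set E(n,k) is moved by h by at most twice the measure of the
  complement of E(n,h), a bound that is uniform in k \<open>\<in>\<close> K.  Strong ergodicity of H therefore forces
  the measure of E(n,k) to be close to 0 or to 1, uniformly in k, for n large.  Being close to 1
  is stable under products, and it holds for generators, so for a large n it holds for all k \<open>\<in>\<close> K.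

  For such an n, the section x \<open>\<mapsto>\<close> [x] of the bundle of classes moves little under K, so the vector of
  least norm in the closed convex hull of its K-orbit is a K-invariant section of norm close to 1.
  On most points it gives [x] a weight above 1/2; within a K-orbit this singles out one
  class, and the points lying in the class singled out form a core A of large measure.

  Finally, h \<open>\<in>\<close> H maps the distinguished class of a K-orbit to the distinguished class of its
  image on a K-invariant set of points.  For generators h this set is non-null, hence conull by ergodicity
  of K.  So all K-orbits inside a G-orbit have the same distinguished class, and the sub-relation
  coincides with the orbit relation on A.
\<close>

section \<open>Finitely supported convex weights\<close>

text \<open>
  A list of pairs (weight, element) stands for a finitely supported function on the group, with
  repetitions added up.  Pushing it forward along \<open>f\<close> gives \<open>wt p f\<close>; \<open>energy p f\<close> is the sum
  of the squares of the values of this push-forward.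
\<close>

definition wt :: "(real \<times> 'g) list \<Rightarrow> ('g \<Rightarrow> 'z) \<Rightarrow> 'z \<Rightarrow> real"
  where "wt p f z = (\<Sum>(r, g)\<leftarrow>p. if f g = z then r else 0)"

definition energy :: "(real \<times> 'g) list \<Rightarrow> ('g \<Rightarrow> 'z) \<Rightarrow> real"
  where "energy p f = (\<Sum>(r, g)\<leftarrow>p. r * wt p f (f g))"

text \<open>Since repetitions add up, concatenating the two halved lists gives the midpoint of the
  two functions.\<close>

definition half_mix :: "(real \<times> 'g) list \<Rightarrow> (real \<times> 'g) list \<Rightarrow> (real \<times> 'g) list"
  where "half_mix p q = map (\<lambda>(r, g). (r / 2, g)) (p @ q)"

lemma wt_Nil [simp]: "wt [] f z = 0"
  by (simp add: wt_def)

lemma wt_Cons [simp]: "wt ((r, g) # p) f z = (if f g = z then r else 0) + wt p f z"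
  by (simp add: wt_def)

lemma wt_half_mix: "wt (half_mix p q) f z = (wt p f z + wt q f z) / 2"
proof -
  have half: "wt (map (\<lambda>(r, g). (r / 2, g)) p) f z = wt p f z / 2" for p
    by (induction p) (auto simp: add_divide_distrib)
  have "wt (p @ q) f z = wt p f z + wt q f z"
    by (simp add: wt_def)
  then show ?thesis
    by (simp only: half_mix_def half)
qed

lemma energy_eq_sum_squares:
  assumes "finite Z" "f ` snd ` set p \<subseteq> Z"
  shows "energy p f = (\<Sum>z\<in>Z. (wt p f z)\<^sup>2)"
proof -
  \<comment> \<open>The energy is the diagonal of a bilinear form. Separating its arguments lets the
    induction unfold \<open>p\<close> while the weight function of \<open>q\<close> stays
    fixed.\<close>
  have "(\<Sum>(r, g)\<leftarrow>p. r * wt q f (f g)) = (\<Sum>z\<in>Z. wt p f z * wt q f z)" for q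
    using assms(2)
  proof (induction p)
    case (Cons a p)
    obtain r g where a: "a = (r, g)" by force
    have "(\<Sum>z\<in>Z. (if f g = z then r else 0) * wt q f z) = (\<Sum>z\<in>Z. if f g = z then r * wt q f z else 0)"
      by (intro sum.cong) auto
    also have "\<dots> = r * wt q f (f g)"
      using Cons.prems assms(1) a by (simp add: sum.delta)
    finally show ?case
      using Cons a by (simp add: distrib_right sum.distrib)
  qed simp
  then show ?thesis
    by (simp add: energy_def power2_eq_square)
qed

text \<open>Parallelogram law for square-summable functions on the labels: the right-hand side is
  the squared norm of the difference, which dominates each squared coordinate.\<close>

lemma wt_diff_square_le:
  "(wt p f z - wt q f z)\<^sup>2 \<le> 2 * energy p f + 2 * energy q f - 4 * energy (half_mix p q) f"
proof -
  define Z where "Z = insert z (f ` snd ` (set p \<union> set q))"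
  have Z: "finite Z" "f ` snd ` set p \<subseteq> Z" "f ` snd ` set q \<subseteq> Z" "z \<in> Z"
    "f ` snd ` set (half_mix p q) \<subseteq> Z"
    by (auto simp: Z_def half_mix_def image_iff) force+
  have "(wt p f z - wt q f z)\<^sup>2 \<le> (\<Sum>z\<in>Z. (wt p f z - wt q f z)\<^sup>2)"
    using Z by (intro member_le_sum) auto
  also have "\<dots> = (\<Sum>z\<in>Z. 2 * (wt p f z)\<^sup>2 + 2 * (wt q f z)\<^sup>2 - 4 * (wt (half_mix p q) f z)\<^sup>2)"
    by (intro sum.cong refl) (simp add: wt_half_mix power2_eq_square field_simps)
  also have "\<dots> = 2 * energy p f + 2 * energy q f - 4 * energy (half_mix p q) f"
    using Z by (simp add: energy_eq_sum_squares[of Z] sum.distrib sum_subtractf sum_distrib_left)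
  finally show ?thesis .
qed

lemma energy_nonneg: "0 \<le> energy p f"
  by (simp add: energy_eq_sum_squares[of "f ` snd ` set p"] sum_nonneg)

text \<open>Finitely supported probability measures on \<open>K\<close>; applied to the translates
  of a section they give the convex hull of its K-orbit.\<close>

definition convex_weights :: "'g set \<Rightarrow> (real \<times> 'g) list set"
  where "convex_weights K = {p. (\<forall>(r, g)\<in>set p. 0 \<le> r \<and> g \<in> K) \<and> sum_list (map fst p) = 1}"

lemma half_mix_convex_weights:
  assumes "p \<in> convex_weights K" "q \<in> convex_weights K"
  shows "half_mix p q \<in> convex_weights K"
proof -
  have half: "sum_list (map fst (map (\<lambda>(r::real, g). (r / 2, g)) p)) = sum_list (map fst p) / 2"
    for p :: "(real \<times> 'a) list"
    by (induction p) (auto simp: add_divide_distrib)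
  show ?thesis
    using assms unfolding convex_weights_def mem_Collect_eq half_mix_def half
    by (auto simp: split_beta)
qed

lemma wt_nonneg:
  assumes "p \<in> convex_weights K"
  shows "0 \<le> wt p f z"
  using assms unfolding wt_def convex_weights_def by (fastforce intro!: sum_list_nonneg)

text \<open>The two masses come from disjoint parts of a list of total weight 1. So at most one
  label carries more than half of the mass, which makes the distinguished class unique.\<close>

lemma wt_disjoint_le_1:
  assumes "p \<in> convex_weights K" "z \<noteq> z'"
  shows "wt p f z + wt p f z' \<le> 1"
proof -
  have "\<forall>(r, g)\<in>set p. 0 \<le> r \<Longrightarrow> wt p f z + wt p f z' \<le> sum_list (map fst p)"
    using assms(2) by (induction p) auto
  moreover have "\<forall>(r, g)\<in>set p. 0 \<le> r" "sum_list (map fst p) = 1"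
    using assms(1) by (auto simp: convex_weights_def)
  ultimately show ?thesis
    by simp
qed

lemma wt_le_1:
  assumes "p \<in> convex_weights K"
  shows "wt p f z \<le> 1"
proof -
  have "\<forall>(r, g)\<in>set p. 0 \<le> r \<Longrightarrow> wt p f z \<le> sum_list (map fst p)"
    by (induction p) auto
  moreover have "\<forall>(r, g)\<in>set p. 0 \<le> r" "sum_list (map fst p) = 1"
    using assms by (auto simp: convex_weights_def)
  ultimately show ?thesis
    by simp
qed

lemma wt_map: "wt (map (\<lambda>(r, g). (r, \<phi> g)) p) f z = wt p (\<lambda>g. f (\<phi> g)) z"
  by (induction p) auto

lemma energy_map: "energy (map (\<lambda>(r, g). (r, \<phi> g)) p) f = energy p (\<lambda>g. f (\<phi> g))"
proof -
  have "(\<Sum>(r, h)\<leftarrow>map (\<lambda>(r, g). (r, \<phi> g)) q. r * w (f h)) = (\<Sum>(r, g)\<leftarrow>q. r * w (f (\<phi> g)))"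
    for q and w :: "'b \<Rightarrow> real"
    by (induction q) auto
  then show ?thesis
    by (simp only: energy_def wt_map)
qed

lemma wt_cong:
  assumes "\<And>r g. (r, g) \<in> set p \<Longrightarrow> f g = f' g"
  shows "wt p f z = wt p f' z"
  unfolding wt_def using assms by (intro arg_cong[of _ _ sum_list] map_cong) auto

lemma energy_cong:
  assumes "\<And>r g. (r, g) \<in> set p \<Longrightarrow> f g = f' g"
  shows "energy p f = energy p f'"
proof -
  have "(\<Sum>(r, g)\<leftarrow>p. r * wt p f (f g)) = (\<Sum>(r, g)\<leftarrow>p. r * wt p f' (f' g))"
    using assms wt_cong[of p f f'] by (intro arg_cong[of _ _ sum_list] map_cong) auto
  then show ?thesis
    by (simp add: energy_def)
qed

section \<open>Almost sure convergence from square-integrable bounds\<close>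

lemma convergent_if_summable_increments:
  fixes u :: "nat \<Rightarrow> real"
  assumes "\<forall>\<^sub>F n in sequentially. \<bar>u (Suc n) - u n\<bar> \<le> (1 / 2) ^ n"
  shows "convergent u"
proof -
  have "summable (\<lambda>n. u (Suc n) - u n)"
  proof (rule summable_comparison_test_ev)
    show "\<forall>\<^sub>F n in sequentially. norm (u (Suc n) - u n) \<le> (1 / 2) ^ n"
      using assms by simp
    show "summable (\<lambda>n. (1 / 2 :: real) ^ n)"
      by (rule summable_geometric) simp
  qed
  then have "convergent (\<lambda>n. \<Sum>i<n. u (Suc i) - u i)"
    by (simp only: summable_iff_convergent)
  then have "convergent (\<lambda>n. u n - u 0)"
    by (simp only: sum_lessThan_telescope)
  then show ?thesis
    by (simp only: convergent_diff_const_right_iff)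
qed

text \<open>Chebyshev's inequality at threshold \<open>(1 / 2) ^ n\<close> divides the bound by
  \<open>(1 / 4) ^ n\<close> and leaves the summable \<open>4 * (1 / 2) ^ n\<close>, so
  Borel-Cantelli applies.\<close>

lemma (in prob_space) AE_eventually_less_half_power:
  fixes u :: "nat \<Rightarrow> 'a \<Rightarrow> real"
  assumes [measurable]: "\<And>n. u n \<in> borel_measurable M"
    and int: "\<And>n. integrable M (\<lambda>x. (u n x)\<^sup>2)"
    and le: "\<And>n. (\<integral>x. (u n x)\<^sup>2 \<partial>M) \<le> 4 * (1 / 8) ^ n"
  shows "AE x in M. \<forall>\<^sub>F n in sequentially. \<bar>u n x\<bar> < (1 / 2) ^ n"
proof -
  define B where "B n = {x \<in> space M. \<bar>u n x\<bar> \<ge> (1 / 2) ^ n}" for n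
  have "measure M (B n) \<le> 4 * (1 / 2) ^ n" for n
  proof -
    have "measure M (B n) \<le> (\<integral>x. (u n x)\<^sup>2 \<partial>M) / ((1 / 2) ^ n)\<^sup>2"
      unfolding B_def by (intro second_moment_method int) auto
    also have "\<dots> \<le> 4 * (1 / 8) ^ n / ((1 / 2) ^ n)\<^sup>2"
      by (intro divide_right_mono le) auto
    also have "\<dots> = 4 * ((1 / 8) / (1 / 2)\<^sup>2) ^ n"
      by (simp only: power2_eq_square power_divide power_mult_distrib times_divide_eq_right)
    also have "\<dots> = 4 * (1 / 2) ^ n"
      by (simp add: power2_eq_square)
    finally show ?thesis .
  qed
  then have le: "norm (measure M (B n)) \<le> 4 * (1 / 2) ^ n" for n
    by simp
  have "summable (\<lambda>n. 4 * (1 / 2 :: real) ^ n)"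
    by (intro summable_mult summable_geometric) simp
  then have "summable (\<lambda>n. measure M (B n))"
    using le by (rule summable_comparison_test')
  moreover have [measurable]: "B n \<in> sets M" for n
    unfolding B_def by measurable
  ultimately have "AE x in M. \<forall>\<^sub>F n in sequentially. x \<in> space M - B n"
    by (intro borel_cantelli_AE1) (auto simp: less_top[symmetric])
  then show ?thesis
    by (rule AE_mp) (intro AE_I2 impI, auto elim!: eventually_mono simp: B_def)
qed

section \<open>Labellings of a p.m.p. action\<close>

locale pmp_system = group G for G (structure) +
  fixes M :: "'x measure" and \<alpha>
  assumes pmp: "pmp_action G M \<alpha>"
begin

sublocale prob_space M
  using pmp by (simp add: pmp_action_def)

sublocale group_action G "space M" \<alpha>
  using pmp by (simp add: pmp_action_def)

lemma action_measurable [measurable]: "g \<in> carrier G \<Longrightarrow> \<alpha> g \<in> measurable M M"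
  using pmp by (simp add: pmp_action_def)

lemma action_distr: "g \<in> carrier G \<Longrightarrow> distr M M (\<alpha> g) = M"
  using pmp by (simp add: pmp_action_def)

lemma action_space: "g \<in> carrier G \<Longrightarrow> x \<in> space M \<Longrightarrow> \<alpha> g x \<in> space M"
  by (rule element_image) auto

lemma action_one: "x \<in> space M \<Longrightarrow> \<alpha> \<one> x = x"
  by (metis id_eq_one restrict_apply')

lemma action_inv: "g \<in> carrier G \<Longrightarrow> x \<in> space M \<Longrightarrow> \<alpha> (inv g) (\<alpha> g x) = x"
  using orbit_sym_aux by blast

lemma action_inv': "g \<in> carrier G \<Longrightarrow> x \<in> space M \<Longrightarrow> \<alpha> g (\<alpha> (inv g) x) = x"
  using action_inv[of "inv g" x] by simp

lemma action_vimage_sets: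
  assumes "g \<in> carrier G" "A \<in> sets M"
  shows "{x \<in> space M. \<alpha> g x \<in> A} \<in> sets M"
  using assms by measurable

lemma prob_action_vimage:
  assumes "g \<in> carrier G" "A \<in> sets M"
  shows "prob {x \<in> space M. \<alpha> g x \<in> A} = prob A"
proof -
  have "prob A = measure (distr M M (\<alpha> g)) A"
    using assms by (simp add: action_distr)
  also have "\<dots> = prob {x \<in> space M. \<alpha> g x \<in> A}"
    using assms by (subst measure_distr) (auto intro!: arg_cong[of _ _ prob])
  finally show ?thesis by simp
qed

lemma AE_action:
  assumes "g \<in> carrier G" "AE x in M. P x"
  shows "AE x in M. P (\<alpha> g x)"
  using AE_distrD[of "\<alpha> g" M M P] assms(2) unfolding action_distr[OF assms(1)]
  by (simp add: assms(1))

lemma action_image: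
  assumes "g \<in> carrier G" "A \<in> sets M"
  shows "\<alpha> g ` A = {x \<in> space M. \<alpha> (inv g) x \<in> A}"
proof safe
  fix x assume "x \<in> A"
  then show "\<alpha> g x \<in> space M" "\<alpha> (inv g) (\<alpha> g x) \<in> A"
    using assms sets.sets_into_space[of A M] by (auto simp: action_inv action_space subset_iff)
next
  fix x assume "x \<in> space M" "\<alpha> (inv g) x \<in> A"
  then show "x \<in> \<alpha> g ` A"
    using assms by (intro image_eqI[of _ _ "\<alpha> (inv g) x"]) (auto simp: action_inv')
qed

text \<open>
  A labelling is meant to be the map to the classes of a Borel equivalence relation.  The space of labels carries no
  measurable structure, so only coincidence of labels is required to be measurable.
\<close>

definition measurable_labelling :: "('x \<Rightarrow> 'z) \<Rightarrow> bool"
  where "measurable_labelling f \<longleftrightarrow>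
    (\<forall>g\<in>carrier G. \<forall>h\<in>carrier G. {x \<in> space M. f (\<alpha> g x) = f (\<alpha> h x)} \<in> sets M)"

text \<open>For the labelling by classes of the n-th sub-relation this is the set E(n,g).\<close>

definition coincidence :: "('x \<Rightarrow> 'z) \<Rightarrow> 'a \<Rightarrow> 'x set"
  where "coincidence f g = {x \<in> space M. f (\<alpha> g x) = f x}"

lemma coincidence_sets [measurable]:
  assumes "measurable_labelling f" "g \<in> carrier G"
  shows "coincidence f g \<in> sets M"
proof -
  have "{x \<in> space M. f (\<alpha> g x) = f (\<alpha> \<one> x)} \<in> sets M"
    using assms unfolding measurable_labelling_def by auto
  then show ?thesis
    by (simp add: coincidence_def action_one cong: conj_cong)
qed

lemma integrable_label_eq:
  assumes "measurable_labelling f" "g \<in> carrier G" "h \<in> carrier G"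
  shows "integrable M (\<lambda>x. if f (\<alpha> g x) = f (\<alpha> h x) then r else (0::real))"
proof -
  have "{x \<in> space M. f (\<alpha> g x) = f (\<alpha> h x)} \<in> sets M"
    using assms unfolding measurable_labelling_def by auto
  then have "integrable M (\<lambda>x. r * indicator {x \<in> space M. f (\<alpha> g x) = f (\<alpha> h x)} x)"
    by (intro integrable_mult_right integrable_real_indicator) (auto simp: less_top[symmetric])
  then show ?thesis
    by (rule Bochner_Integration.integrable_cong[THEN iffD1, rotated 2]) (auto simp: indicator_def)
qed

lemma integrable_wt:
  assumes f: "measurable_labelling f" and p: "snd ` set p \<subseteq> carrier G" and h: "h \<in> carrier G"
  shows "integrable M (\<lambda>x. wt p (\<lambda>g. f (\<alpha> g x)) (f (\<alpha> h x)))"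
  using p by (induction p) (auto intro!: Bochner_Integration.integrable_add integrable_label_eq f h)

lemma integrable_energy:
  assumes f: "measurable_labelling f" and p: "snd ` set p \<subseteq> carrier G"
  shows "integrable M (\<lambda>x. energy p (\<lambda>g. f (\<alpha> g x)))"
proof -
  have "integrable M (\<lambda>x. \<Sum>(r, h)\<leftarrow>q. r * wt p (\<lambda>g. f (\<alpha> g x)) (f (\<alpha> h x)))"
    if "snd ` set q \<subseteq> carrier G" for q :: "(real \<times> 'a) list"
    using that
    by (induction q) (auto intro!: Bochner_Integration.integrable_add integrable_mult_right integrable_wt f p)
  then show ?thesis
    using p by (simp add: energy_def)
qed

text \<open>The integral is linear in \<open>p\<close>, and a unit mass at \<open>k\<close>
  contributes the measure of \<open>coincidence f k\<close>.\<close>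

lemma integral_wt_ge:
  assumes f: "measurable_labelling f" and K: "K \<subseteq> carrier G"
    and p: "p \<in> convex_weights K" and c: "\<And>k. k \<in> K \<Longrightarrow> c \<le> prob (coincidence f k)"
  shows "c \<le> (\<integral>x. wt p (\<lambda>g. f (\<alpha> g x)) (f x) \<partial>M)"
proof -
  \<comment> \<open>The total mass is left arbitrary, because the tail of a list of total weight 1
    need not have weight 1. Writing \<open>\<alpha> \<one> x\<close> for \<open>x\<close> fits the
    integrability lemmas.\<close>
  have bound: "sum_list (map fst p) * c \<le> (\<integral>x. wt p (\<lambda>g. f (\<alpha> g x)) (f (\<alpha> \<one> x)) \<partial>M)"
    if "\<forall>(r, g)\<in>set p. 0 \<le> r \<and> g \<in> K" for p :: "(real \<times> 'a) list"
    using that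
  proof (induction p)
    case (Cons a p)
    obtain r g where a: "a = (r, g)" by force
    have g: "g \<in> K" "g \<in> carrier G" "r \<ge> 0" "snd ` set p \<subseteq> carrier G" using Cons a K by auto
    have "r * c \<le> r * prob (coincidence f g)"
      using g by (intro mult_left_mono c) auto
    also have "\<dots> = (\<integral>x. r * indicator (coincidence f g) x \<partial>M)"
      using g f by (simp add: coincidence_sets)
    also have "\<dots> = (\<integral>x. (if f (\<alpha> g x) = f (\<alpha> \<one> x) then r else 0) \<partial>M)"
      by (intro Bochner_Integration.integral_cong) (auto simp: coincidence_def action_one)
    finally show ?case
      using Cons g f unfolding a
      by (simp add: integrable_wt integrable_label_eq Bochner_Integration.integral_add distrib_right)
  qed simp
  have "c \<le> (\<integral>x. wt p (\<lambda>g. f (\<alpha> g x)) (f (\<alpha> \<one> x)) \<partial>M)"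
    using bound[of p] p by (auto simp: convex_weights_def)
  also have "(\<integral>x. wt p (\<lambda>g. f (\<alpha> g x)) (f (\<alpha> \<one> x)) \<partial>M) = (\<integral>x. wt p (\<lambda>g. f (\<alpha> g x)) (f x) \<partial>M)"
    by (intro Bochner_Integration.integral_cong) (auto simp: action_one)
  finally show ?thesis .
qed

text \<open>Right multiplication by \<open>k\<close> amounts to evaluating at
  \<open>\<alpha> k x\<close> in place of \<open>x\<close>, and \<open>\<alpha> k\<close> preserves
  the measure.\<close>

lemma integral_energy_translate:
  assumes f: "measurable_labelling f" and p: "snd ` set p \<subseteq> carrier G" and k: "k \<in> carrier G"
  shows "(\<integral>x. energy (map (\<lambda>(r, g). (r, g \<otimes> k)) p) (\<lambda>g. f (\<alpha> g x)) \<partial>M)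
    = (\<integral>x. energy p (\<lambda>g. f (\<alpha> g x)) \<partial>M)"
proof -
  have "(\<integral>x. energy (map (\<lambda>(r, g). (r, g \<otimes> k)) p) (\<lambda>g. f (\<alpha> g x)) \<partial>M)
    = (\<integral>x. energy p (\<lambda>g. f (\<alpha> g (\<alpha> k x))) \<partial>M)"
    using p k unfolding energy_map
    by (intro Bochner_Integration.integral_cong energy_cong) (auto simp: composition_rule image_subset_iff)
  also have "\<dots> = (\<integral>x. energy p (\<lambda>g. f (\<alpha> g x)) \<partial>distr M M (\<alpha> k))"
    using k by (subst integral_distr) (auto intro!: borel_measurable_integrable integrable_energy f p)
  finally show ?thesis
    using k by (simp add: action_distr)
qed

end

text \<open>The mean energy is a squared norm invariant under \<open>K\<close>, so near-minimisers
  are close to each other and to their own translates. Only the value \<eta> of the limit section at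
  the label of the point itself is constructed; invariance recovers the values at the labels of
  translates.\<close>

lemma (in pmp_system) exists_core:
  assumes f: "measurable_labelling f" and K: "subgroup K G" "countable K"
    and c: "\<And>k. k \<in> K \<Longrightarrow> 1 - t \<le> prob (coincidence f k)"
  shows "\<exists>A\<in>sets M. 1 - 2 * t \<le> prob A \<and>
    (AE x in M. \<forall>k\<in>K. x \<in> A \<longrightarrow> \<alpha> k x \<in> A \<longrightarrow> f (\<alpha> k x) = f x)"
proof -
  have KG: "K \<subseteq> carrier G" and K1: "\<one> \<in> K" and Km: "\<And>g h. g \<in> K \<Longrightarrow> h \<in> K \<Longrightarrow> g \<otimes> h \<in> K"
    using K(1) by (auto simp: subgroup_def)
  \<comment> \<open>A weight \<open>p\<close> gives each \<open>x\<close> a function on labels: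
    \<open>v p b x\<close> is its value at the label of \<open>\<alpha> b x\<close>, and
    \<open>e p x\<close> is its squared norm.\<close>
  define v where "v p b x = wt p (\<lambda>g. f (\<alpha> g x)) (f (\<alpha> b x))" for p b x
  define e where "e p x = energy p (\<lambda>g. f (\<alpha> g x))" for p x
  define \<Phi> where "\<Phi> p = (\<integral>x. e p x \<partial>M)" for p
  define P where "P = convex_weights K"
  define I where "I = (INF p\<in>P. \<Phi> p)"
  define tr where "tr p k = map (\<lambda>(r::real, g). (r, g \<otimes> k)) p" for p k
  have PG: "snd ` set p \<subseteq> carrier G" if "p \<in> P" for p
    using that KG by (auto simp: P_def convex_weights_def)
  have v_int: "integrable M (v p b)" if "p \<in> P" "b \<in> K" for p b
    using that KG unfolding v_def by (intro integrable_wt f PG) auto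
  have e_int: "integrable M (e p)" if "p \<in> P" for p
    using that unfolding e_def by (intro integrable_energy f PG)
  have v_meas: "v p b \<in> borel_measurable M" if "p \<in> P" "b \<in> K" for p b
    using v_int[OF that] by auto
  have v_ge0: "0 \<le> v p b x" if "p \<in> P" for p b x
    using that unfolding P_def v_def by (rule wt_nonneg)
  have v_disj: "v p b x + v p b' x \<le> 1" if "p \<in> P" "f (\<alpha> b x) \<noteq> f (\<alpha> b' x)" for p b b' x
    using that unfolding P_def v_def by (rule wt_disjoint_le_1)
  have v_le1: "v p b x \<le> 1" if "p \<in> P" for p b x
    using wt_le_1 that unfolding P_def v_def by fast
  have \<Phi>_ge0: "0 \<le> \<Phi> p" for p
    unfolding \<Phi>_def e_def by (intro integral_nonneg_AE AE_I2 energy_nonneg)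
  have I_le: "I \<le> \<Phi> p" if "p \<in> P" for p
    unfolding I_def using that \<Phi>_ge0 by (intro cINF_lower) (auto intro: bdd_belowI2[of _ 0])
  have P_ne: "P \<noteq> {}"
    using K1 by (auto simp: P_def convex_weights_def intro!: exI[of _ "[(1, \<one>)]"])
  have tr_P: "tr p k \<in> P" if "p \<in> P" "k \<in> K" for p k
  proof -
    have "map fst (tr p k) = map fst p"
      by (auto simp: tr_def)
    moreover have "\<forall>(r, g)\<in>set (tr p k). 0 \<le> r \<and> g \<in> K"
      using that Km by (auto simp: P_def convex_weights_def tr_def)
    ultimately show ?thesis
      using that(1) by (simp add: P_def convex_weights_def)
  qed
  have tr_\<Phi>: "\<Phi> (tr p k) = \<Phi> p" if "p \<in> P" "k \<in> K" for p k
    using that KG unfolding \<Phi>_def e_def tr_def by (intro integral_energy_translate f PG) auto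
  \<comment> \<open>This trades the value at the label of another orbit point for a value at the
    moved point's own label.\<close>
  have tr_v: "v (tr p k) k x = v p \<one> (\<alpha> k x)" if "p \<in> P" "k \<in> K" "x \<in> space M" for p k x
    unfolding v_def tr_def wt_map using that KG PG[of p]
    by (auto simp: action_one action_space composition_rule image_subset_iff subset_iff intro!: wt_cong)
  have diff_int: "integrable M (\<lambda>x. (v p b x - v q b x)\<^sup>2)" if "p \<in> P" "q \<in> P" "b \<in> K" for p q b
  proof (rule integrable_const_bound[of _ 1])
    have "\<bar>v p b x - v q b x\<bar> \<le> 1" for x
      using v_ge0[OF that(1), of b x] v_ge0[OF that(2), of b x] v_le1[OF that(1), of b x] v_le1[OF that(2), of b x]
      by linarith
    then show "AE x in M. norm ((v p b x - v q b x)\<^sup>2) \<le> 1"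
      by (simp add: abs_square_le_1)
  qed (use v_meas that in measurable)
  \<comment> \<open>parallelogram law in the Hilbert space of sections of the bundle of labels\<close>
  have near: "(\<integral>x. (v p b x - v q b x)\<^sup>2 \<partial>M) \<le> 4 * d"
    if pq: "p \<in> P" "q \<in> P" and b: "b \<in> K" and d: "\<Phi> p \<le> I + d" "\<Phi> q \<le> I + d" for p q b d
  proof -
    have m: "half_mix p q \<in> P"
      using pq unfolding P_def by (rule half_mix_convex_weights)
    have "(\<integral>x. (v p b x - v q b x)\<^sup>2 \<partial>M) \<le> (\<integral>x. 2 * e p x + 2 * e q x - 4 * e (half_mix p q) x \<partial>M)"
    proof (rule integral_mono)
      show "integrable M (\<lambda>x. 2 * e p x + 2 * e q x - 4 * e (half_mix p q) x)"
        using pq m by (simp add: e_int)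
    qed (use pq b in \<open>auto simp: v_def e_def wt_diff_square_le intro: diff_int[unfolded v_def]\<close>)
    also have "\<dots> = 2 * \<Phi> p + 2 * \<Phi> q - 4 * \<Phi> (half_mix p q)"
      using pq m by (simp add: e_int \<Phi>_def)
    finally show ?thesis
      using I_le[OF m] d by linarith
  qed
  \<comment> \<open>With the factor 4 from \<open>near\<close>, this excess over the infimum gives
    exactly the bound required by \<open>AE_eventually_less_half_power\<close>.\<close>
  have "\<exists>p\<in>P. \<Phi> p < I + (1 / 8) ^ n" for n
    using P_ne \<Phi>_ge0 unfolding I_def
    by (subst cINF_less_iff[symmetric]) (auto intro: bdd_belowI2[of _ 0])
  then obtain p where p: "\<And>n. p n \<in> P" and p_lt: "\<And>n::nat. \<Phi> (p n) < I + (1 / 8) ^ n"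
    by metis
  define u where "u n x = v (p n) \<one> x" for n x
  have u_meas [measurable]: "u n \<in> borel_measurable M" for n
    unfolding u_def using p K1 by (auto intro: v_meas)
  have "AE x in M. \<forall>\<^sub>F n in sequentially. \<bar>u (Suc n) x - u n x\<bar> < (1 / 2) ^ n"
  proof (rule AE_eventually_less_half_power)
    fix n
    have "(1 / 8 :: real) ^ Suc n \<le> (1 / 8) ^ n"
      by simp
    then have "\<Phi> (p (Suc n)) \<le> I + (1 / 8) ^ n"
      using p_lt[of "Suc n"] by linarith
    then show "(\<integral>x. (u (Suc n) x - u n x)\<^sup>2 \<partial>M) \<le> 4 * (1 / 8) ^ n"
      unfolding u_def using p less_imp_le[OF p_lt[of n]] K1 by (intro near) auto
    show "integrable M (\<lambda>x. (u (Suc n) x - u n x)\<^sup>2)"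
      unfolding u_def using p K1 by (intro diff_int) auto
  qed measurable
  then have conv: "AE x in M. convergent (\<lambda>n. u n x)"
    by (rule AE_mp) (intro AE_I2 impI convergent_if_summable_increments, auto elim: eventually_mono)
  \<comment> \<open>Where the sequence diverges, \<open>lim\<close> is an arbitrary value; by
    \<open>conv\<close> this happens on a null set only.\<close>
  define \<eta> where "\<eta> x = lim (\<lambda>n. u n x)" for x
  have \<eta>_meas [measurable]: "\<eta> \<in> borel_measurable M"
    unfolding \<eta>_def by measurable
  have lim: "AE x in M. (\<lambda>n. u n x) \<longlonglongrightarrow> \<eta> x"
    using conv by eventually_elim (simp add: \<eta>_def convergent_LIMSEQ_iff)
  have u_bd: "0 \<le> u n x" "u n x \<le> 1" for n x
    using p v_ge0 v_le1 by (auto simp: u_def)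
  \<comment> \<open>Invariance of the limit: \<open>p n\<close> and \<open>tr (p n) b\<close> are
    both near-minimal, so their values at the label of \<open>\<alpha> b x\<close> have the same
    limit, and the second value is \<open>u n (\<alpha> b x)\<close>.\<close>
  have "AE x in M. (\<lambda>n. v (p n) b x) \<longlonglongrightarrow> \<eta> (\<alpha> b x)" if b: "b \<in> K" for b
  proof -
    have bG: "b \<in> carrier G" using b KG by auto
    have "AE x in M. \<forall>\<^sub>F n in sequentially. \<bar>v (p n) b x - v (tr (p n) b) b x\<bar> < (1 / 2) ^ n"
    proof (rule AE_eventually_less_half_power)
      fix n
      show "(\<integral>x. (v (p n) b x - v (tr (p n) b) b x)\<^sup>2 \<partial>M) \<le> 4 * (1 / 8) ^ n"
        using p p_lt[of n] b by (intro near tr_P) (auto simp: tr_\<Phi>)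
      show "integrable M (\<lambda>x. (v (p n) b x - v (tr (p n) b) b x)\<^sup>2)"
        using p b by (intro diff_int tr_P)
      show "(\<lambda>x. v (p n) b x - v (tr (p n) b) b x) \<in> borel_measurable M"
        using p b by (intro borel_measurable_diff v_meas tr_P)
    qed
    moreover have "AE x in M. (\<lambda>n. u n (\<alpha> b x)) \<longlonglongrightarrow> \<eta> (\<alpha> b x)"
      using lim by (rule AE_action[OF bG])
    ultimately show ?thesis
      using AE_space
    proof eventually_elim
      case (elim x)
      have "(\<lambda>n. v (p n) b x - v (tr (p n) b) b x) \<longlonglongrightarrow> 0"
        by (rule tendsto_0_le[of "\<lambda>n. (1 / 2 :: real) ^ n" _ _ 1])
          (use elim(1) in \<open>auto intro!: LIMSEQ_power_zero elim: eventually_mono\<close>)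
      then have "(\<lambda>n. (v (p n) b x - v (tr (p n) b) b x) + u n (\<alpha> b x)) \<longlonglongrightarrow> 0 + \<eta> (\<alpha> b x)"
        using elim(2) by (rule tendsto_add)
      then show ?case
        using elim(3) p b by (simp add: tr_v u_def)
    qed
  qed
  then have lim_K: "AE x in M. \<forall>b\<in>K. (\<lambda>n. v (p n) b x) \<longlonglongrightarrow> \<eta> (\<alpha> b x)"
    using K(2) by (simp add: AE_ball_countable)
  define A where "A = {x \<in> space M. 1 / 2 < \<eta> x}"
  have A [measurable]: "A \<in> sets M"
    unfolding A_def by measurable
  have "AE x in M. \<forall>k\<in>K. x \<in> A \<longrightarrow> \<alpha> k x \<in> A \<longrightarrow> f (\<alpha> k x) = f x"
    using lim_K lim AE_space
  proof eventually_elim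
    case (elim x)
    show ?case
    proof (intro ballI impI, rule ccontr)
      fix k assume k: "k \<in> K" "x \<in> A" "\<alpha> k x \<in> A" "f (\<alpha> k x) \<noteq> f x"
      \<comment> \<open>Both labels would have limiting weight above 1/2 at \<open>x\<close>, while
        the two weights add up to at most 1.\<close>
      have "(\<lambda>n. v (p n) k x + u n x) \<longlonglongrightarrow> \<eta> (\<alpha> k x) + \<eta> x"
        using elim k by (intro tendsto_add) auto
      moreover have "v (p n) k x + u n x \<le> 1" for n
        unfolding u_def using k elim(3) p by (intro v_disj) (auto simp: action_one)
      ultimately have "\<eta> (\<alpha> k x) + \<eta> x \<le> 1"
        by (intro LIMSEQ_le_const2) auto
      then show False
        using k by (auto simp: A_def)
    qed
  qed
  moreover have "1 - 2 * t \<le> prob A"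
  proof -
    have "(\<lambda>n. \<integral>x. u n x \<partial>M) \<longlonglongrightarrow> (\<integral>x. \<eta> x \<partial>M)"
      using lim u_bd by (intro integral_dominated_convergence[where w = "\<lambda>_. 1"]) auto
    moreover have "1 - t \<le> (\<integral>x. u n x \<partial>M)" for n
    proof -
      have "1 - t \<le> (\<integral>x. wt (p n) (\<lambda>g. f (\<alpha> g x)) (f x) \<partial>M)"
        using f KG p c unfolding P_def by (rule integral_wt_ge)
      also have "\<dots> = (\<integral>x. u n x \<partial>M)"
        unfolding u_def v_def by (intro Bochner_Integration.integral_cong) (auto simp: action_one)
      finally show ?thesis .
    qed
    ultimately have "1 - t \<le> (\<integral>x. \<eta> x \<partial>M)"
      by (intro LIMSEQ_le_const) auto
    \<comment> \<open>Here \<eta> is at most 1 on \<open>A\<close> and at most 1/2 elsewhere.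
      Solving for \<open>prob A\<close> produces the factor 2 in front of \<open>t\<close>.\<close>
    also have "\<dots> \<le> (\<integral>x. 1 / 2 + indicator A x / 2 \<partial>M)"
    proof (rule integral_mono_AE)
      show "integrable M (\<lambda>x. 1 / 2 + indicator A x / 2 :: real)"
        by (intro Bochner_Integration.integrable_add integrable_const integrable_divide_zero
          integrable_real_indicator A) (simp add: less_top[symmetric])
      have bd: "AE x in M. 0 \<le> \<eta> x \<and> \<eta> x \<le> 1"
        using lim by eventually_elim (use u_bd in \<open>auto intro: LIMSEQ_le_const LIMSEQ_le_const2\<close>)
      then show "AE x in M. \<eta> x \<le> 1 / 2 + indicator A x / 2"
        using AE_space by eventually_elim (auto simp: A_def indicator_def)
      show "integrable M \<eta>"
        using bd by (intro integrable_const_bound[of _ 1]) auto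
    qed
    also have "\<dots> = 1 / 2 + prob A / 2"
      using A by (subst Bochner_Integration.integral_add) (auto simp: prob_space less_top[symmetric])
    finally show ?thesis
      by simp
  qed
  ultimately show ?thesis
    using A by blast
qed

section \<open>Almost invariant coincidence sets\<close>

lemma (in group) countable_generate:
  assumes "countable S" "S \<subseteq> carrier G"
  shows "countable (generate G S)"
proof -
  define T where "T = S \<union> m_inv G ` S"
  define W where "W = (\<lambda>ws. foldr (\<otimes>) ws \<one>) ` lists T"
  have T: "T \<subseteq> carrier G"
    using assms by (auto simp: T_def)
  have closed: "foldr (\<otimes>) ws \<one> \<in> carrier G" if "ws \<in> lists T" for ws
    using that T by (induction ws) auto
  have append: "foldr (\<otimes>) (us @ ws) \<one> = foldr (\<otimes>) us \<one> \<otimes> foldr (\<otimes>) ws \<one>"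
    if "us \<in> lists T" "ws \<in> lists T" for us ws
    using that(1) T closed closed[OF that(2)] by (induction us) (auto simp: m_assoc subset_iff)
  have "g \<in> W" if "g \<in> generate G S" for g
    using that
  proof (induction rule: generate.induct)
    case one
    show ?case by (auto simp: W_def intro!: image_eqI[of _ _ "[]"])
  next
    case (incl h)
    then show ?case
      using assms by (auto simp: W_def T_def intro!: image_eqI[of _ _ "[h]"])
  next
    case (inv h)
    then show ?case
      using assms by (auto simp: W_def T_def intro!: image_eqI[of _ _ "[m_inv G h]"])
  next
    case (eng h1 h2)
    then obtain us ws where "us \<in> lists T" "ws \<in> lists T"
      "h1 = foldr (\<otimes>) us \<one>" "h2 = foldr (\<otimes>) ws \<one>"
      by (auto simp: W_def)
    then show ?case
      unfolding W_def by (intro image_eqI[of _ _ "us @ ws"]) (auto simp: append simp del: foldr_append)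
  qed
  moreover have "countable W"
    using assms by (simp add: W_def T_def)
  ultimately show ?thesis
    by (meson countable_subset subsetI)
qed

text \<open>The inner factors of a product of two such elements commute, so the form is kept. In
  this order \<open>h\<close> acts first, and \<open>\<alpha> (k \<otimes> h) x\<close> lies in the
  K-orbit of \<open>\<alpha> h x\<close>.\<close>

lemma (in group) commuting_generate_eq_mult:
  assumes H: "subgroup H G" and K: "subgroup K G" and comm: "commuting_subgroups G H K"
    and "g \<in> generate G (H \<union> K)"
  shows "\<exists>k\<in>K. \<exists>h\<in>H. g = k \<otimes> h"
  using assms(4)
proof (induction rule: generate.induct)
  case one
  show ?case
    using subgroup.one_closed[OF H] subgroup.one_closed[OF K] by force
next
  case (incl g)
  then show ?case
    using subgroup.one_closed[OF H] subgroup.one_closed[OF K] subgroup.mem_carrier[OF H]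
      subgroup.mem_carrier[OF K] by (metis UnE l_one r_one)
next
  case (inv g)
  then show ?case
    using subgroup.one_closed[OF H] subgroup.one_closed[OF K] subgroup.mem_carrier[OF H]
      subgroup.mem_carrier[OF K] subgroup.m_inv_closed[OF H] subgroup.m_inv_closed[OF K]
    by (metis UnE l_one r_one)
next
  case (eng g1 g2)
  then obtain k1 h1 k2 h2 where *: "k1 \<in> K" "h1 \<in> H" "k2 \<in> K" "h2 \<in> H" "g1 = k1 \<otimes> h1" "g2 = k2 \<otimes> h2"
    by blast
  have car: "k1 \<in> carrier G" "h1 \<in> carrier G" "k2 \<in> carrier G" "h2 \<in> carrier G"
    using * subgroup.mem_carrier[OF H] subgroup.mem_carrier[OF K] by auto
  have "g1 \<otimes> g2 = k1 \<otimes> (h1 \<otimes> k2) \<otimes> h2"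
    using * car by (simp add: m_assoc)
  also have "h1 \<otimes> k2 = k2 \<otimes> h1"
    using comm * by (auto simp: commuting_subgroups_def)
  also have "k1 \<otimes> (k2 \<otimes> h1) \<otimes> h2 = (k1 \<otimes> k2) \<otimes> (h1 \<otimes> h2)"
    using car by (simp add: m_assoc)
  finally show ?case
    using * subgroup.m_closed[OF H] subgroup.m_closed[OF K] by blast
qed

section \<open>Coincidence probabilities under strong ergodicity\<close>

context pmp_system
begin

lemma prob_coincidence_inv:
  assumes "measurable_labelling f" "g \<in> carrier G"
  shows "prob (coincidence f (inv g)) = prob (coincidence f g)"
proof -
  have "coincidence f g = {x \<in> space M. \<alpha> g x \<in> coincidence f (inv g)}"
    using assms by (auto simp: coincidence_def action_inv action_space)
  then show ?thesis
    using prob_action_vimage[of g "coincidence f (inv g)"] assms by (simp add: coincidence_sets)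
qed

text \<open>The labels of ghx and hx agree, and so do those of hx and x, off two exceptional sets;
  the first is pulled back along the measure-preserving \<open>\<alpha> h\<close>.\<close>

lemma prob_coincidence_mult:
  assumes f: "measurable_labelling f" and g: "g \<in> carrier G" "h \<in> carrier G"
  shows "prob (coincidence f g) + prob (coincidence f h) - 1 \<le> prob (coincidence f (g \<otimes> h))"
proof -
  define B where "B = {x \<in> space M. \<alpha> h x \<in> coincidence f g}"
  note [measurable] = coincidence_sets[OF f]
  have B [measurable]: "B \<in> sets M"
    unfolding B_def using g by measurable
  have pB: "prob B = prob (coincidence f g)"
    unfolding B_def using g by (intro prob_action_vimage) auto
  have sub: "space M - coincidence f (g \<otimes> h) \<subseteq> (space M - B) \<union> (space M - coincidence f h)"
    using g by (auto simp: B_def coincidence_def composition_rule action_space)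
  have "prob (space M - coincidence f (g \<otimes> h)) \<le> prob ((space M - B) \<union> (space M - coincidence f h))"
    using g by (intro finite_measure_mono sub) auto
  also have "\<dots> \<le> prob (space M - B) + prob (space M - coincidence f h)"
    using g by (intro measure_Un_le) auto
  finally show ?thesis
    using g pB by (simp add: prob_compl)
qed

text \<open>Off \<open>E\<close> and \<open>B\<close> complements, the inverse of \<open>h\<close>
  changes neither the label of \<open>x\<close> nor that of \<open>\<alpha> k x\<close>, so it does
  not change membership in \<open>coincidence f k\<close>. Both complements have the measure of the
  complement of \<open>coincidence f h\<close>.\<close>

lemma prob_coincidence_image_le:
  assumes f: "measurable_labelling f" and hk: "h \<in> carrier G" "k \<in> carrier G"
    and comm: "h \<otimes> k = k \<otimes> h"
  shows "prob (sym_diff (coincidence f k) (\<alpha> h ` coincidence f k)) \<le> 2 * (1 - prob (coincidence f h))"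
proof -
  define E where "E = coincidence f (inv h)"
  define B where "B = {x \<in> space M. \<alpha> k x \<in> E}"
  note [measurable] = coincidence_sets[OF f]
  have E [measurable]: "E \<in> sets M"
    unfolding E_def using hk by auto
  have B [measurable]: "B \<in> sets M"
    unfolding B_def using hk by measurable
  have pB: "prob B = prob E"
    unfolding B_def using hk by (intro prob_action_vimage) auto
  have inv_comm: "\<alpha> (inv h) (\<alpha> k x) = \<alpha> k (\<alpha> (inv h) x)" if "x \<in> space M" for x
  proof -
    have "inv h \<otimes> k = k \<otimes> inv h"
      by (metis comm hk inv_closed inv_solve_left inv_solve_right m_assoc m_closed)
    then show ?thesis
      using that hk composition_rule[of x "inv h" k] composition_rule[of x k "inv h"] by simp
  qed
  have img: "\<alpha> h ` coincidence f k = {x \<in> space M. \<alpha> (inv h) x \<in> coincidence f k}"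
    using hk by (intro action_image) auto
  have "sym_diff (coincidence f k) (\<alpha> h ` coincidence f k) \<subseteq> (space M - E) \<union> (space M - B)"
    unfolding img using hk
    by (auto simp: E_def B_def coincidence_def action_space inv_comm)
  then have "prob (sym_diff (coincidence f k) (\<alpha> h ` coincidence f k)) \<le> prob ((space M - E) \<union> (space M - B))"
    by (intro finite_measure_mono) auto
  also have "\<dots> \<le> prob (space M - E) + prob (space M - B)"
    by (intro measure_Un_le) auto
  also have "\<dots> = 2 * (1 - prob E)"
    by (simp add: prob_compl pB)
  finally show ?thesis
    using f hk by (simp add: E_def prob_coincidence_inv)
qed

text \<open>Strong ergodicity concerns one sequence of sets. Uniformity in \<open>k\<close> comes
  from applying it to a sequence of counterexamples, which is legitimate because the invariance
  bound does not involve \<open>k\<close>.\<close>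

lemma strongly_ergodic_coincidence_dichotomy:
  fixes f :: "nat \<Rightarrow> 'x \<Rightarrow> 'z"
  assumes f: "\<And>n. measurable_labelling (f n)"
    and lim: "\<And>h. h \<in> H \<Longrightarrow> (\<lambda>n. prob (coincidence (f n) h)) \<longlonglongrightarrow> 1"
    and serg: "strongly_ergodic H M \<alpha>" and H: "H \<subseteq> carrier G" and K: "K \<subseteq> carrier G" "K \<noteq> {}"
    and comm: "commuting_subgroups G H K" and "0 < (\<epsilon>::real)"
  shows "\<forall>\<^sub>F n in sequentially. \<forall>k\<in>K. prob (coincidence (f n) k) * (1 - prob (coincidence (f n) k)) < \<epsilon>"
proof -
  let ?bad = "\<lambda>n k. k \<in> K \<and> \<not> prob (coincidence (f n) k) * (1 - prob (coincidence (f n) k)) < \<epsilon>"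
  \<comment> \<open>A violating element if there is one, otherwise any element of \<open>K\<close>,
    so that \<open>\<kappa> n\<close> lies in \<open>K\<close> in all cases.\<close>
  define \<kappa> where "\<kappa> n = (if \<exists>k. ?bad n k then SOME k. ?bad n k else SOME k. k \<in> K)" for n
  have \<kappa>: "\<kappa> n \<in> K" for n
    unfolding \<kappa>_def using someI_ex[of "?bad n"] K(2) by (auto simp: some_in_eq)
  have \<kappa>_bad: "?bad n (\<kappa> n)" if "\<exists>k. ?bad n k" for n
    using someI_ex[OF that] that unfolding \<kappa>_def by simp
  define A where "A n = coincidence (f n) (\<kappa> n)" for n
  have "(\<lambda>n. prob (A n) * (1 - prob (A n))) \<longlonglongrightarrow> 0"
  proof (rule serg[unfolded strongly_ergodic_def, rule_format])
    show "A n \<in> sets M" for n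
      unfolding A_def using \<kappa> K f by (auto intro: coincidence_sets)
    fix h assume h: "h \<in> H"
    have "prob (sym_diff (A n) (\<alpha> h ` A n)) \<le> 2 * (1 - prob (coincidence (f n) h))" for n
      unfolding A_def using h H \<kappa>[of n] K comm f
      by (intro prob_coincidence_image_le) (auto simp: commuting_subgroups_def)
    then have "\<forall>\<^sub>F n in sequentially.
        norm (prob (sym_diff (A n) (\<alpha> h ` A n))) \<le> 2 * (1 - prob (coincidence (f n) h))"
      by simp
    moreover have "(\<lambda>n. 2 * (1 - prob (coincidence (f n) h))) \<longlonglongrightarrow> 2 * (1 - 1)"
      by (intro tendsto_intros lim h)
    then have "(\<lambda>n. 2 * (1 - prob (coincidence (f n) h))) \<longlonglongrightarrow> 0"
      by (simp only: diff_self mult_zero_right)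
    ultimately show "(\<lambda>n. prob (sym_diff (A n) (\<alpha> h ` A n))) \<longlonglongrightarrow> 0"
      by (rule Lim_null_comparison)
  qed
  then have "\<forall>\<^sub>F n in sequentially. prob (A n) * (1 - prob (A n)) < \<epsilon>"
    using \<open>0 < \<epsilon>\<close> by (rule order_tendstoD)
  then show ?thesis
    by eventually_elim (use \<kappa>_bad in \<open>auto simp: A_def\<close>)
qed

text \<open>The hypothesis \<open>dich\<close> keeps the probabilities out of the interval from
  \<open>t\<close> to \<open>1 - t\<close>. A product of two good elements stays above
  \<open>1 - 2 * t\<close>, hence above \<open>t\<close>, and so lies beyond the interval.\<close>

lemma coincidence_gt_on_generate:
  assumes f: "measurable_labelling f" and S: "S \<subseteq> carrier G" and t: "0 < t" "3 * t < 1"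
    and gen: "\<And>s. s \<in> S \<Longrightarrow> 1 - t < prob (coincidence f s)"
    and dich: "\<And>k. k \<in> generate G S \<Longrightarrow>
      prob (coincidence f k) * (1 - prob (coincidence f k)) < t * (1 - t)"
    and "k \<in> generate G S"
  shows "1 - t < prob (coincidence f k)"
  using \<open>k \<in> generate G S\<close>
proof (induction rule: generate.induct)
  case one
  have "coincidence f \<one> = space M"
    by (auto simp: coincidence_def action_one)
  then show ?case
    using t by (simp add: prob_space)
next
  case (inv h)
  then show ?case
    using gen S f by (auto simp: prob_coincidence_inv)
next
  case (eng h1 h2)
  define p where "p = prob (coincidence f (h1 \<otimes> h2))"
  have "h1 \<in> carrier G" "h2 \<in> carrier G"
    using eng.hyps generate_in_carrier[OF S] by auto
  then have "t < p"
    using eng.IH t prob_coincidence_mult[OF f, of h1 h2] by (simp add: p_def)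
  \<comment> \<open>The product equals \<open>t * (1 - t) - p * (1 - p)\<close>. Its factors have
    the same sign, and the first one is positive.\<close>
  moreover have "0 < (p - t) * (p - (1 - t))"
    using dich[OF generate.eng[OF eng.hyps]] by (simp add: p_def algebra_simps)
  ultimately show ?case
    by (simp add: p_def zero_less_mult_iff)
qed (rule gen)

end

section \<open>Extending the core by ergodicity\<close>

context pmp_system
begin

text \<open>Agreement of the labels attached to the K-orbits of \<open>x\<close> and
  \<open>\<alpha> h x\<close> is a K-invariant condition, as \<open>h\<close> commutes with
  \<open>K\<close>; by ergodicity positive measure suffices. The inequality \<open>large\<close>
  yields this for generators, and conullity passes to their inverses and to products.\<close>

lemma core_extends:
  assumes H: "subgroup H G" and K: "subgroup K G" and comm: "commuting_subgroups G H K"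
    and prod: "\<And>g. g \<in> carrier G \<Longrightarrow> \<exists>k\<in>K. \<exists>h\<in>H. g = k \<otimes> h"
    and count: "countable (carrier G)" and erg: "ergodic K M \<alpha>"
    and f: "measurable_labelling f" and A: "A \<in> sets M"
    and core: "AE x in M. \<forall>k\<in>K. x \<in> A \<longrightarrow> \<alpha> k x \<in> A \<longrightarrow> f (\<alpha> k x) = f x"
    and S: "S \<subseteq> carrier G" "generate G S = H"
    and large: "\<And>s. s \<in> S \<Longrightarrow> 2 < 2 * prob A + prob (coincidence f s)" and pos: "0 < prob A"
  shows "AE x in M. \<forall>g\<in>carrier G. x \<in> A \<longrightarrow> \<alpha> g x \<in> A \<longrightarrow> f (\<alpha> g x) = f x"
proof -
  note [measurable] = A
  note [simp] = subgroup.mem_carrier[OF H] subgroup.mem_carrier[OF K]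
  note closed = subgroup.m_closed[OF K] subgroup.m_inv_closed[OF K] subgroup.one_closed[OF K]
  have commD: "h \<otimes> k = k \<otimes> h" if "h \<in> H" "k \<in> K" for h k
    using comm that by (auto simp: commuting_subgroups_def)
  have countK: "countable K"
    using count subgroup.subset[OF K] by (rule countable_subset[rotated])
  define D where "D h = {x \<in> space M. \<exists>k\<in>K. \<exists>k'\<in>K.
      \<alpha> k x \<in> A \<and> \<alpha> (k' \<otimes> h) x \<in> A \<and> f (\<alpha> k x) = f (\<alpha> (k' \<otimes> h) x)}" for h
  have D_sets [measurable]: "D h \<in> sets M" if [simp]: "h \<in> carrier G" for h
  proof -
    have "{x \<in> space M. \<alpha> k x \<in> A \<and> \<alpha> (k' \<otimes> h) x \<in> A \<and> f (\<alpha> k x) = f (\<alpha> (k' \<otimes> h) x)} \<in> sets M"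
      if "k \<in> K" "k' \<in> K" for k k'
    proof -
      have "{x \<in> space M. f (\<alpha> k x) = f (\<alpha> (k' \<otimes> h) x)} \<in> sets M"
        using f that unfolding measurable_labelling_def by auto
      moreover have "{x \<in> space M. \<alpha> k x \<in> A} \<in> sets M" "{x \<in> space M. \<alpha> (k' \<otimes> h) x \<in> A} \<in> sets M"
        using that A by (auto intro!: action_vimage_sets)
      ultimately have "{x \<in> space M. \<alpha> k x \<in> A} \<inter> {x \<in> space M. \<alpha> (k' \<otimes> h) x \<in> A}
          \<inter> {x \<in> space M. f (\<alpha> k x) = f (\<alpha> (k' \<otimes> h) x)} \<in> sets M"
        by blast
      then show ?thesis
        by (rule back_subst[of "\<lambda>E. E \<in> sets M"]) auto
    qed
    then have "(\<Union>k\<in>K. \<Union>k'\<in>K. {x \<in> space M. \<alpha> k x \<in> A \<and> \<alpha> (k' \<otimes> h) x \<in> A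
        \<and> f (\<alpha> k x) = f (\<alpha> (k' \<otimes> h) x)}) \<in> sets M"
      using countK by (intro sets.countable_UN') auto
    then show ?thesis
      by (rule back_subst[of "\<lambda>E. E \<in> sets M"]) (auto simp: D_def)
  qed
  \<comment> \<open>Passing from \<open>\<alpha> c x\<close> to \<open>x\<close> only renames the
    witnesses: \<open>k\<close> becomes \<open>k \<otimes> c\<close> and, as \<open>c\<close>
    commutes with \<open>h\<close>, \<open>k'\<close> becomes \<open>k' \<otimes> c\<close>.\<close>
  have D_inv: "x \<in> D h" if h: "h \<in> H" and c: "c \<in> K" and x: "x \<in> space M" and D: "\<alpha> c x \<in> D h" for h c x
  proof -
    obtain k k' where k: "k \<in> K" "k' \<in> K" "\<alpha> k (\<alpha> c x) \<in> A" "\<alpha> (k' \<otimes> h) (\<alpha> c x) \<in> A"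
      "f (\<alpha> k (\<alpha> c x)) = f (\<alpha> (k' \<otimes> h) (\<alpha> c x))"
      using D by (auto simp: D_def)
    have "k' \<otimes> h \<otimes> c = k' \<otimes> c \<otimes> h"
      using k h c commD[OF h c] by (simp add: m_assoc)
    then have "\<alpha> k (\<alpha> c x) = \<alpha> (k \<otimes> c) x" "\<alpha> (k' \<otimes> h) (\<alpha> c x) = \<alpha> (k' \<otimes> c \<otimes> h) x"
      using k h c x composition_rule[of x "k' \<otimes> h" c] composition_rule[of x k c] by auto
    then show ?thesis
      using k x c closed unfolding D_def by auto
  qed
  have D_conull: "AE x in M. x \<in> D h" if h: "h \<in> H" and D: "0 < prob (D h)" for h
  proof -
    have "sym_diff (D h) (\<alpha> c ` D h) = {}" if c: "c \<in> K" for c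
    proof -
      have img: "\<alpha> c ` D h = {x \<in> space M. \<alpha> (inv c) x \<in> D h}"
        using c h by (intro action_image) auto
      have "\<alpha> (inv c) x \<in> D h \<longleftrightarrow> x \<in> D h" if x: "x \<in> space M" for x
      proof
        assume "\<alpha> (inv c) x \<in> D h"
        then show "x \<in> D h"
          by (rule D_inv[OF h closed(2)[OF c] x])
      next
        assume "x \<in> D h"
        then have "\<alpha> c (\<alpha> (inv c) x) \<in> D h"
          using c x by (simp add: action_inv')
        moreover have "\<alpha> (inv c) x \<in> space M"
          using c x by (simp add: action_space)
        ultimately show "\<alpha> (inv c) x \<in> D h"
          by (rule D_inv[OF h c, rotated])
      qed
      then have "\<alpha> c ` D h = D h"
        unfolding img using sets.sets_into_space[OF D_sets[of h]] h by auto
      then show ?thesis by simp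
    qed
    then have "prob (D h) = 1"
      using erg D h unfolding ergodic_def by (metis D_sets less_irrefl measure_empty subgroup.mem_carrier[OF H])
    then show ?thesis
      using h by (simp add: prob_eq_1)
  qed
  \<comment> \<open>Countability of the group allows \<open>core\<close> at all points of the orbit
    at once. It is used at \<open>\<alpha> (k' \<otimes> g) x\<close> with the element
    \<open>k \<otimes> inv k'\<close>.\<close>
  have core_orbit: "AE x in M. \<forall>g\<in>carrier G. \<forall>k\<in>K. \<forall>k'\<in>K. \<alpha> (k \<otimes> g) x \<in> A \<longrightarrow>
      \<alpha> (k' \<otimes> g) x \<in> A \<longrightarrow> f (\<alpha> (k \<otimes> g) x) = f (\<alpha> (k' \<otimes> g) x)"
  proof -
    have "AE x in M. \<forall>g\<in>carrier G. \<forall>k\<in>K. \<alpha> g x \<in> A \<longrightarrow> \<alpha> k (\<alpha> g x) \<in> A \<longrightarrow> f (\<alpha> k (\<alpha> g x)) = f (\<alpha> g x)"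
      using count AE_action[OF _ core] by (simp add: AE_ball_countable)
    then show ?thesis
      using AE_space
    proof eventually_elim
      case (elim x)
      show ?case
      proof (intro ballI impI)
        fix g k k' assume *: "g \<in> carrier G" "k \<in> K" "k' \<in> K" "\<alpha> (k \<otimes> g) x \<in> A" "\<alpha> (k' \<otimes> g) x \<in> A"
        have "k \<otimes> inv k' \<otimes> (k' \<otimes> g) = k \<otimes> g"
          using * by (simp add: m_assoc inv_solve_left')
        then have "\<alpha> (k \<otimes> inv k') (\<alpha> (k' \<otimes> g) x) = \<alpha> (k \<otimes> g) x"
          using * elim(2) composition_rule[of x "k \<otimes> inv k'" "k' \<otimes> g"] by simp
        then show "f (\<alpha> (k \<otimes> g) x) = f (\<alpha> (k' \<otimes> g) x)"
          using * elim(1) closed by (metis m_closed subgroup.mem_carrier[OF K])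
      qed
    qed
  qed
  have D_generator: "AE x in M. x \<in> D s" if s: "s \<in> S" for s
  proof (rule D_conull)
    have sG: "s \<in> carrier G" using s S by auto
    show "s \<in> H" using s S generate.incl by fastforce
    define B where "B = {x \<in> space M. \<alpha> s x \<in> A}"
    have B [measurable]: "B \<in> sets M"
      unfolding B_def using sG by measurable
    have C [measurable]: "coincidence f s \<in> sets M"
      using f sG by (rule coincidence_sets)
    \<comment> \<open>Off the three complements, \<open>x\<close> and \<open>\<alpha> s x\<close>
      are points of \<open>A\<close> with equal labels, so \<one> serves as both witnesses.\<close>
    have "prob (space M - D s) \<le> prob ((space M - A) \<union> (space M - B) \<union> (space M - coincidence f s))"
    proof (rule finite_measure_mono)
      have "x \<in> D s" if "x \<in> A" "x \<in> B" "x \<in> coincidence f s" for x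
        using that sG closed(3) unfolding D_def B_def coincidence_def
        by (auto intro!: bexI[of _ \<one>] simp: action_one)
      then show "space M - D s \<subseteq> (space M - A) \<union> (space M - B) \<union> (space M - coincidence f s)"
        by auto
    qed auto
    also have "\<dots> \<le> prob (space M - A) + prob (space M - B) + prob (space M - coincidence f s)"
      by (intro order.trans[OF measure_Un_le] add_mono order.refl) auto
    also have "\<dots> < 1"
      using prob_action_vimage[OF sG A] large[OF s] by (simp add: prob_compl B_def[symmetric])
    finally show "0 < prob (D s)"
      using sG by (simp add: prob_compl)
  qed
  have D_H: "AE x in M. x \<in> D h" if "h \<in> H" for h
    using that unfolding S(2)[symmetric]
  proof (induction rule: generate.induct)
    case one
    show ?case
    proof (rule D_conull)
      show "\<one> \<in> H" using H by (rule subgroup.one_closed)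
      have "A \<subseteq> D \<one>"
        using A[THEN sets.sets_into_space] closed(3) by (auto simp: D_def action_one intro!: bexI[of _ \<one>])
      then have "prob A \<le> prob (D \<one>)"
        by (intro finite_measure_mono) auto
      then show "0 < prob (D \<one>)"
        using pos by simp
    qed
  next
    case (inv s)
    have sG: "s \<in> carrier G" using inv S by auto
    have "AE x in M. \<alpha> (inv s) x \<in> D s"
      using sG D_generator[OF inv] by (intro AE_action) auto
    then show ?case
      using AE_space
    proof eventually_elim
      case (elim x)
      then obtain k k' where k: "k \<in> K" "k' \<in> K" "\<alpha> k (\<alpha> (inv s) x) \<in> A" "\<alpha> (k' \<otimes> s) (\<alpha> (inv s) x) \<in> A"
        "f (\<alpha> k (\<alpha> (inv s) x)) = f (\<alpha> (k' \<otimes> s) (\<alpha> (inv s) x))"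
        by (auto simp: D_def)
      have "\<alpha> k (\<alpha> (inv s) x) = \<alpha> (k \<otimes> inv s) x" "\<alpha> (k' \<otimes> s) (\<alpha> (inv s) x) = \<alpha> k' x"
        using k sG elim composition_rule[of x "k' \<otimes> s" "inv s"] composition_rule[of x k "inv s"]
        by (auto simp: m_assoc)
      \<comment> \<open>Seen from \<open>x\<close> instead of \<open>\<alpha> (inv s) x\<close>, the
        two witnesses swap roles.\<close>
      then have "\<alpha> k' x \<in> A \<and> \<alpha> (k \<otimes> inv s) x \<in> A \<and> f (\<alpha> k' x) = f (\<alpha> (k \<otimes> inv s) x)"
        using k by simp
      then show ?case
        using k(1,2) elim(2) unfolding D_def by blast
    qed
  next
    case (eng h1 h2)
    have h: "h1 \<in> carrier G" "h2 \<in> carrier G"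
      using eng.hyps generate_in_carrier[OF S(1)] by auto
    have "AE x in M. \<alpha> h2 x \<in> D h1"
      using h eng.IH by (intro AE_action)
    then show ?case
      using eng.IH(2) core_orbit AE_space
    proof eventually_elim
      case (elim x)
      obtain k1 k1' where k1: "k1 \<in> K" "k1' \<in> K" "\<alpha> k1 (\<alpha> h2 x) \<in> A" "\<alpha> (k1' \<otimes> h1) (\<alpha> h2 x) \<in> A"
        "f (\<alpha> k1 (\<alpha> h2 x)) = f (\<alpha> (k1' \<otimes> h1) (\<alpha> h2 x))"
        using elim by (auto simp: D_def)
      obtain k2 k2' where k2: "k2 \<in> K" "k2' \<in> K" "\<alpha> k2 x \<in> A" "\<alpha> (k2' \<otimes> h2) x \<in> A"
        "f (\<alpha> k2 x) = f (\<alpha> (k2' \<otimes> h2) x)"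
        using elim by (auto simp: D_def)
      have eq: "\<alpha> k1 (\<alpha> h2 x) = \<alpha> (k1 \<otimes> h2) x" "\<alpha> (k1' \<otimes> h1) (\<alpha> h2 x) = \<alpha> (k1' \<otimes> (h1 \<otimes> h2)) x"
        using k1 h elim composition_rule[of x "k1' \<otimes> h1" h2] composition_rule[of x k1 h2]
        by (auto simp: m_assoc)
      have "\<alpha> (k1 \<otimes> h2) x \<in> A"
        using k1(3) unfolding eq .
      \<comment> \<open>The two agreements use possibly different points of \<open>A\<close> in the
        K-orbit of \<open>\<alpha> h2 x\<close>; \<open>core_orbit\<close> glues them.\<close>
      then have "f (\<alpha> (k2' \<otimes> h2) x) = f (\<alpha> (k1 \<otimes> h2) x)"
        by (rule elim(3)[rule_format, OF h(2) k2(2) k1(1) k2(4)])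
      then have "\<alpha> k2 x \<in> A \<and> \<alpha> (k1' \<otimes> (h1 \<otimes> h2)) x \<in> A \<and> f (\<alpha> k2 x) = f (\<alpha> (k1' \<otimes> (h1 \<otimes> h2)) x)"
        using k1 k2 unfolding eq by simp
      then show ?case
        using k1(2) k2(1) elim(4) unfolding D_def by blast
    qed
  qed (rule D_generator)
  have "countable H"
    using count subgroup.subset[OF H] by (rule countable_subset[rotated])
  then have "AE x in M. \<forall>h\<in>H. x \<in> D h"
    using D_H by (simp add: AE_ball_countable)
  then show ?thesis
    using core_orbit AE_space
  proof eventually_elim
    case (elim x)
    show ?case
    proof (intro ballI impI)
      fix g assume g: "g \<in> carrier G" "x \<in> A" "\<alpha> g x \<in> A"
      obtain k h where kh: "k \<in> K" "h \<in> H" "g = k \<otimes> h"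
        using prod[OF g(1)] by blast
      obtain a b where ab: "a \<in> K" "b \<in> K" "\<alpha> a x \<in> A" "\<alpha> (b \<otimes> h) x \<in> A" "f (\<alpha> a x) = f (\<alpha> (b \<otimes> h) x)"
        using elim(1) kh by (auto simp: D_def)
      \<comment> \<open>The factors \<one> cast the comparison of \<open>\<alpha> a x\<close> with
        \<open>x\<close> as an instance of \<open>core_orbit\<close> at the identity.\<close>
      have "f (\<alpha> (a \<otimes> \<one>) x) = f (\<alpha> (\<one> \<otimes> \<one>) x)"
        using ab(1,3) g(2) elim(3) by (intro elim(2)[rule_format] closed(3)) (simp_all add: action_one)
      moreover have "f (\<alpha> (b \<otimes> h) x) = f (\<alpha> (k \<otimes> h) x)"
        using ab(2,4) kh g(3) by (intro elim(2)[rule_format]) simp_all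
      ultimately show "f (\<alpha> g x) = f x"
        using ab kh elim(3) by (simp add: action_one)
    qed
  qed
qed

end

section \<open>Approximations of the orbit relation\<close>

context pmp_system
begin

lemma class_eq_iff:
  assumes "borel_equiv_rel M R" "x \<in> space M" "y \<in> space M"
  shows "R `` {x} = R `` {y} \<longleftrightarrow> (x, y) \<in> R"
  using assms eq_equiv_class_iff[of "space M" R x y] by (simp only: borel_equiv_rel_def)

text \<open>Equality of classes is membership in \<open>R\<close>, so the set is the preimage of
  \<open>R\<close> under the measurable map
  \<open>x \<mapsto> (\<alpha> g x, \<alpha> h x)\<close>.\<close>

lemma measurable_labelling_class:
  assumes "borel_equiv_rel M R"
  shows "measurable_labelling (\<lambda>x. R `` {x})"
  unfolding measurable_labelling_def
proof (intro ballI)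
  fix g h assume [simp]: "g \<in> carrier G" "h \<in> carrier G"
  have R: "R \<in> sets (M \<Otimes>\<^sub>M M)"
    using assms by (simp add: borel_equiv_rel_def)
  have "(\<lambda>x. (\<alpha> g x, \<alpha> h x)) -` R \<inter> space M \<in> sets M"
    by (rule measurable_sets[OF _ R]) measurable
  moreover have "(\<lambda>x. (\<alpha> g x, \<alpha> h x)) -` R \<inter> space M = {x \<in> space M. R `` {\<alpha> g x} = R `` {\<alpha> h x}}"
    by (intro Set.set_eqI) (simp add: class_eq_iff[OF assms] action_space conj_commute cong: conj_cong)
  ultimately show "{x \<in> space M. R `` {\<alpha> g x} = R `` {\<alpha> h x}} \<in> sets M"
    by simp
qed

lemma AE_approximation_eventually:
  assumes appr: "approximation M (orbit_rel G M \<alpha>) Rs" and g: "g \<in> carrier G"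
  shows "AE x in M. \<forall>\<^sub>F n in sequentially. (x, \<alpha> g x) \<in> Rs n"
proof -
  obtain N where N: "\<And>n. N n \<in> null_sets M"
    "\<And>n. Restr (Rs n) (space M - N n) \<subseteq> Restr (Rs (Suc n)) (space M - N n)"
    using appr unfolding approximation_def ae_subrel_def by metis
  obtain N' where N': "N' \<in> null_sets M"
    "Restr (\<Union>n. Rs n) (space M - N') = Restr (orbit_rel G M \<alpha>) (space M - N')"
    using appr unfolding approximation_def ae_eqrel_def by blast
  \<comment> \<open>One null set for the countably many inclusions. As \<open>\<alpha> g\<close>
    preserves the measure, almost every \<open>x\<close> has both \<open>x\<close> and
    \<open>\<alpha> g x\<close> outside it.\<close>
  define Z where "Z = N' \<union> (\<Union>n. N n)"
  have "Z \<in> null_sets M"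
    unfolding Z_def using N N' by auto
  then have Z: "AE x in M. x \<notin> Z"
    by (rule AE_not_in)
  show ?thesis
    using Z AE_action[OF g Z] AE_space
  proof eventually_elim
    case (elim x)
    have sp: "x \<in> space M - Z" "\<alpha> g x \<in> space M - Z"
      using elim g by (auto simp: action_space)
    have "(x, \<alpha> g x) \<in> orbit_rel G M \<alpha>"
      using elim g by (auto simp: orbit_rel_def)
    then have "(x, \<alpha> g x) \<in> Restr (\<Union>n. Rs n) (space M - N')"
      unfolding N'(2) using sp by (auto simp: Z_def)
    then obtain m where m: "(x, \<alpha> g x) \<in> Rs m"
      by blast
    have "(x, \<alpha> g x) \<in> Rs n" if "m \<le> n" for n
      using that
    proof (induction rule: dec_induct)
      case (step n)
      then have "(x, \<alpha> g x) \<in> Restr (Rs n) (space M - N n)"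
        using sp by (auto simp: Z_def)
      then show ?case
        using N(2)[of n] by blast
    qed (rule m)
    then show ?case
      by (auto simp: eventually_sequentially)
  qed
qed

text \<open>Dominated convergence for the indicators of the coincidence sets, which are eventually 1
  at almost every point.\<close>

lemma prob_coincidence_approximation_tendsto:
  assumes appr: "approximation M (orbit_rel G M \<alpha>) Rs" and g: "g \<in> carrier G"
  shows "(\<lambda>n. prob (coincidence (\<lambda>x. Rs n `` {x}) g)) \<longlonglongrightarrow> 1"
proof -
  have R: "borel_equiv_rel M (Rs n)" for n
    using appr by (simp add: approximation_def)
  define E where "E n = coincidence (\<lambda>x. Rs n `` {x}) g" for n
  have E [measurable]: "E n \<in> sets M" for n
    unfolding E_def using g R by (intro coincidence_sets measurable_labelling_class)
  have "(\<lambda>n. \<integral>x. indicator (E n) x \<partial>M) \<longlonglongrightarrow> (\<integral>x. (1::real) \<partial>M)"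
  proof (rule integral_dominated_convergence[where w = "\<lambda>_. 1"])
    show "AE x in M. (\<lambda>n. indicator (E n) x) \<longlonglongrightarrow> (1::real)"
      using AE_approximation_eventually[OF appr g] AE_space
    proof eventually_elim
      case (elim x)
      have "\<forall>\<^sub>F n in sequentially. indicator (E n) x = (1::real)"
        using elim(1)
      proof eventually_elim
        case (elim n)
        then have "Rs n `` {x} = Rs n `` {\<alpha> g x}"
          using class_eq_iff[OF R] \<open>x \<in> space M\<close> g by (simp add: action_space)
        then show ?case
          using \<open>x \<in> space M\<close> by (simp add: E_def coincidence_def)
      qed
      then show ?case
        by (rule tendsto_eventually)
    qed
  qed (auto simp: indicator_def)
  then show ?thesis
    by (simp add: E_def[symmetric] prob_space)
qed

text \<open>One inclusion is part of being an approximation, the other is \<open>core\<close>; their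
  two null sets are united.\<close>

lemma trivial_approximationI:
  assumes appr: "approximation M (orbit_rel G M \<alpha>) Rs" and A: "A \<in> sets M" "0 < prob A"
    and core: "AE x in M. \<forall>g\<in>carrier G. x \<in> A \<longrightarrow> \<alpha> g x \<in> A \<longrightarrow> Rs n `` {\<alpha> g x} = Rs n `` {x}"
  shows "trivial_approximation M (orbit_rel G M \<alpha>) Rs"
proof -
  have R: "borel_equiv_rel M (Rs n)"
    using appr by (simp add: approximation_def)
  obtain N where N: "N \<in> null_sets M"
    "Restr (Rs n) (space M - N) \<subseteq> Restr (orbit_rel G M \<alpha>) (space M - N)"
    using appr unfolding approximation_def ae_subrel_def by blast
  obtain N' where N': "N' \<in> null_sets M"
    "{x \<in> space M. \<not> (\<forall>g\<in>carrier G. x \<in> A \<longrightarrow> \<alpha> g x \<in> A \<longrightarrow> Rs n `` {\<alpha> g x} = Rs n `` {x})} \<subseteq> N'"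
    using core by (auto simp: eventually_ae_filter)
  have "Restr (Restr (Rs n) A) (space M - (N \<union> N')) = Restr (Restr (orbit_rel G M \<alpha>) A) (space M - (N \<union> N'))"
  proof (intro Set.set_eqI iffI)
    fix z assume "z \<in> Restr (Restr (Rs n) A) (space M - (N \<union> N'))"
    then show "z \<in> Restr (Restr (orbit_rel G M \<alpha>) A) (space M - (N \<union> N'))"
      using N(2) by blast
  next
    fix z assume z: "z \<in> Restr (Restr (orbit_rel G M \<alpha>) A) (space M - (N \<union> N'))"
    then obtain x g where xg: "z = (x, \<alpha> g x)" "g \<in> carrier G"
      by (auto simp: orbit_rel_def)
    have "Rs n `` {x} = Rs n `` {\<alpha> g x}"
      using z xg N'(2) by blast
    then have "(x, \<alpha> g x) \<in> Rs n"
      using class_eq_iff[OF R, of x "\<alpha> g x"] z xg by simp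
    then show "z \<in> Restr (Restr (Rs n) A) (space M - (N \<union> N'))"
      using z xg by blast
  qed
  moreover have "N \<union> N' \<in> null_sets M"
    using N N' by auto
  ultimately show ?thesis
    unfolding trivial_approximation_def ae_eqrel_def using A by blast
qed

end

section \<open>Choice of the index and conclusion\<close>

theorem mainTheorem1:
  fixes G :: "('g, 'b) monoid_scheme"
    and H K :: "'g set"
    and M :: "'x measure"
    and \<alpha> :: "'g \<Rightarrow> 'x \<Rightarrow> 'x"
  assumes "group G"
    and "finitely_generated_subgroup G H" and "infinite H"
    and "finitely_generated_subgroup G K" and "infinite K"
    and "commuting_subgroups G H K"
    and "generate G (H \<union> K) = carrier G"
    and "standard_borel M"
    and "pmp_action G M \<alpha>"
    and "free_action G M \<alpha>"
    and "strongly_ergodic H M \<alpha>"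
    and "ergodic K M \<alpha>"
  shows "\<not> (\<exists>Rs. approximation M (orbit_rel G M \<alpha>) Rs \<and>
               \<not> trivial_approximation M (orbit_rel G M \<alpha>) Rs)"
\<comment> \<open>It remains to show that an arbitrary approximation is trivial.\<close>
proof (rule notI, elim exE conjE, erule notE)
  fix Rs assume appr: "approximation M (orbit_rel G M \<alpha>) Rs"
  interpret pmp_system G M \<alpha>
    using assms(1,9) by (simp add: pmp_system_def pmp_system_axioms_def)
  obtain S T where H: "subgroup H G" and S: "finite S" "S \<subseteq> carrier G" "generate G S = H"
    and K: "subgroup K G" and T: "finite T" "T \<subseteq> carrier G" "generate G T = K"
    using assms(2,4) by (auto simp: finitely_generated_subgroup_def)
  have KG: "K \<subseteq> carrier G" "K \<noteq> {}" and HG: "H \<subseteq> carrier G"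
    using H K by (auto simp: subgroup_def)
  have prod: "\<exists>k\<in>K. \<exists>h\<in>H. g = k \<otimes>\<^bsub>G\<^esub> h" if "g \<in> carrier G" for g
    using commuting_generate_eq_mult[OF H K assms(6)] that assms(7) by simp
  have "countable H" and countK: "countable K"
    using countable_generate[of S] countable_generate[of T] S T by (auto simp: countable_finite)
  moreover have "carrier G \<subseteq> (\<lambda>(k, h). k \<otimes>\<^bsub>G\<^esub> h) ` (K \<times> H)"
    using prod by force
  ultimately have count: "countable (carrier G)"
    by (meson countable_SIGMA countable_image countable_subset)
  define f where "f n x = Rs n `` {x}" for n x
  have f: "measurable_labelling (f n)" for n
    unfolding f_def using appr by (intro measurable_labelling_class) (simp add: approximation_def)
  have lim: "(\<lambda>n. prob (coincidence (f n) g)) \<longlonglongrightarrow> 1" if "g \<in> carrier G" for g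
    unfolding f_def using appr that by (rule prob_coincidence_approximation_tendsto)
  \<comment> \<open>The gap argument asks for \<open>3 * t < 1\<close>, positivity of the core for
    \<open>2 * t < 1\<close>, and \<open>large\<close> in \<open>core_extends\<close> for
    \<open>2 * (1 - 2 * t) + (1 - t) \<ge> 2\<close>; every positive \<open>t\<close> below 1/5
    meets all three.\<close>
  define t :: real where "t = 1 / 16"
  have dich: "\<forall>\<^sub>F n in sequentially. \<forall>k\<in>K. prob (coincidence (f n) k) * (1 - prob (coincidence (f n) k)) < t * (1 - t)"
    using f lim assms(11) HG KG assms(6)
    by (intro strongly_ergodic_coincidence_dichotomy[where H = H]) (auto simp: t_def)
  have gens: "\<forall>\<^sub>F n in sequentially. \<forall>s\<in>S \<union> T. 1 - t < prob (coincidence (f n) s)"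
    using S T lim by (intro eventually_ball_finite ballI order_tendstoD(1)[of _ 1]) (auto simp: t_def)
  \<comment> \<open>A single index works for all of \<open>K\<close> by uniformity of the dichotomy,
    and for all generators by finiteness of \<open>S\<close> and \<open>T\<close>.\<close>
  obtain n where n: "\<And>k. k \<in> K \<Longrightarrow> prob (coincidence (f n) k) * (1 - prob (coincidence (f n) k)) < t * (1 - t)"
    "\<And>s. s \<in> S \<union> T \<Longrightarrow> 1 - t < prob (coincidence (f n) s)"
    using eventually_happens'[OF _ eventually_conj[OF dich gens]] by auto
  have "1 - t < prob (coincidence (f n) k)" if "k \<in> K" for k
  proof (rule coincidence_gt_on_generate[OF f T(2)])
    show "k \<in> generate G T"
      using that T(3) by simp
  qed (use n T(3) in \<open>auto simp: t_def\<close>)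
  then have large: "1 - t \<le> prob (coincidence (f n) k)" if "k \<in> K" for k
    using that by (simp add: less_imp_le)
  obtain A where A: "A \<in> sets M" "1 - 2 * t \<le> prob A"
    "AE x in M. \<forall>k\<in>K. x \<in> A \<longrightarrow> \<alpha> k x \<in> A \<longrightarrow> f n (\<alpha> k x) = f n x"
    using exists_core[OF f K countK large] by blast
  have pos: "0 < prob A"
    using A(2) by (simp add: t_def)
  have "AE x in M. \<forall>g\<in>carrier G. x \<in> A \<longrightarrow> \<alpha> g x \<in> A \<longrightarrow> f n (\<alpha> g x) = f n x"
  proof (rule core_extends[OF H K assms(6) prod count assms(12) f A(1,3) S(2,3) _ pos])
    fix s assume "s \<in> S"
    then show "2 < 2 * prob A + prob (coincidence (f n) s)"
      using n(2)[of s] A(2) by (simp add: t_def)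
  qed
  then show "trivial_approximation M (orbit_rel G M \<alpha>) Rs"
    unfolding f_def by (rule trivial_approximationI[OF appr A(1) pos])
qed

end
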